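(* Let $G$ be the graph with vertex set $\mathbb{Z}$ and edge set $\bigcup_{k\ge 0}E_k$ defined in the context, and let $B_j(0)$ be the set of vertices at graph distance at most $j$ from $0$ in $G$. For each integer $j\ge 1$ let $f(j)=\sup\{n\in\mathbb{Z}_{\ge 0}: n2^n+1\le j\}$, let $p(n)=\frac{n^2+3n+2}{2}$, let $g(j)=2^{p(f(j))-1}$, and let $F(j)=2g(j)+1$ (informally, $F(j)\approx j^{.5\log j}$). Then $$F(j)\le |B_j(0)|\le 16\,j^2\,F(j).$$
   Context: The graph $G$ has vertex set $\mathbb{Z}$ and (undirected) edge set $E=\bigcup_{k\ge 0}E_k$, where $E_0=\{(i,i+1): i\in\mathbb{Z}\}$ and, for each integer $k\ge 1$, $E_k=\{(2^k(n-\tfrac12),\,2^k(n+\tfrac12)): n\in\mathbb{Z}\}$. Distances are graph distances in $G$. Here $\log$ is the logarithm to base 2. The symbol $\approx$ in the parenthetical remark is used informally, as a description of the size of $F$, and is given no precise definition. *)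

theory Defs
  imports Complex_Main "Graph_Theory.Shortest_Path" "Graph_Theory.Pair_Digraph"
begin

definition level_edges :: "nat \<Rightarrow> (int \<times> int) set" where
  "level_edges k =
     (if k = 0 then {(i, i + 1) | i. True}
      else {(u, v). \<exists>n::int. real_of_int u = 2 ^ k * (real_of_int n - 1 / 2) \<and>
                            real_of_int v = 2 ^ k * (real_of_int n + 1 / 2)})"

(* An undirected edge is represented by the two arcs joining its endpoints. *)
definition hier_graph :: "int pair_pre_digraph" where
  "hier_graph = \<lparr> pverts = UNIV,
     parcs = (\<Union>k. level_edges k) \<union> (\<Union>k. level_edges k)\<inverse> \<rparr>"

lemma bidirected_hier_graph: "pair_bidirected_digraph hier_graph"
proof unfold_locales
  show "symmetric hier_graph"
    unfolding symmetric_def hier_graph_def by (auto intro!: symI)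
  show "fst e \<noteq> snd e" if "e \<in> parcs hier_graph" for e
    using that by (auto simp: hier_graph_def level_edges_def split: if_splits)
qed (auto simp: hier_graph_def)

lemma wf_hier_graph: "wf_digraph (with_proj hier_graph)"
proof -
  interpret pair_bidirected_digraph hier_graph by (rule bidirected_hier_graph)
  show ?thesis by (rule wf_digraph_axioms)
qed

(* Graph distance: the least cost of a walk when every arc has cost 1. *)
definition hier_dist :: "int \<Rightarrow> int \<Rightarrow> ereal" where
  "hier_dist u v = wf_digraph.\<mu> (with_proj hier_graph) (\<lambda>_. 1) u v"

definition hier_ball :: "int \<Rightarrow> nat \<Rightarrow> int set" where
  "hier_ball x j = {v \<in> pverts hier_graph. hier_dist x v \<le> ereal (real j)}"

definition growth_f :: "nat \<Rightarrow> nat" where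
  "growth_f j = Sup {n. n * 2 ^ n + 1 \<le> j}"

(* The division is exact: the numerator is (n + 1) * (n + 2). *)
definition growth_p :: "nat \<Rightarrow> nat" where
  "growth_p n = (n ^ 2 + 3 * n + 2) div 2"

(* growth_p is at least 1, so the subtraction is not truncated. *)
definition growth_g :: "nat \<Rightarrow> nat" where
  "growth_g j = 2 ^ (growth_p (growth_f j) - 1)"

definition growth_F :: "nat \<Rightarrow> nat" where
  "growth_F j = 2 * growth_g j + 1"

end

theory Submission
  imports Defs
begin

text \<open>Apart from the unit edges, the edges join \<open>u\<close> to \<open>u \<plusminus> 2 ^ (m + 1)\<close> where \<open>m\<close> is the 2-adic
  valuation of both endpoints (level \<open>m\<close>). To get from \<open>0\<close> to \<open>2 ^ b\<close> one climbs to a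
  level \<open>a < b\<close>, runs along it and descends again, which costs \<open>2 * c a + 2 ^ (b - a - 1) - 1\<close>
  if \<open>c a\<close> is the cost of \<open>2 ^ a\<close>. The optimal choice gives \<open>c (e n) = n * 2 ^ n + 1\<close> for
  \<open>e n = growth_p n - 1 = n * (n + 3) / 2\<close>. Hence with \<open>n = growth_f j\<close> the ball contains the interval
  of radius \<open>2 ^ e n\<close>, while no level \<open>\<ge> e (n + 1)\<close> is reached within \<open>j\<close> steps, so that each step
  moves by at most \<open>2 ^ e (n + 1) = 2 ^ e n * 2 ^ (n + 2) \<le> 4 * j * 2 ^ e n\<close>.\<close>

section \<open>Edges and 2-adic levels\<close>

lemma hier_arc_unit: "(u, u + 1) \<in> parcs hier_graph" "(u + 1, u) \<in> parcs hier_graph"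
proof -
  have "(u, u + 1) \<in> level_edges 0"
    by (simp add: level_edges_def)
  then show "(u, u + 1) \<in> parcs hier_graph" "(u + 1, u) \<in> parcs hier_graph"
    by (auto simp: hier_graph_def)
qed

lemma hier_arc_level:
  "(2 ^ m * (2 * q + 1), 2 ^ m * (2 * q + 3)) \<in> parcs hier_graph"
  "(2 ^ m * (2 * q + 3), 2 ^ m * (2 * q + 1)) \<in> parcs hier_graph"
proof -
  have "(2 ^ m * (2 * q + 1), 2 ^ m * (2 * q + 3)) \<in> level_edges (Suc m)"
    by (auto simp: level_edges_def algebra_simps intro!: exI[of _ "q + 1"])
  then show "(2 ^ m * (2 * q + 1), 2 ^ m * (2 * q + 3)) \<in> parcs hier_graph"
    "(2 ^ m * (2 * q + 3), 2 ^ m * (2 * q + 1)) \<in> parcs hier_graph"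
    unfolding hier_graph_def by auto
qed

lemma level_edges_Suc_cases:
  assumes "(u, v) \<in> level_edges (Suc m)"
  obtains q where "u = 2 ^ m * (2 * q + 1)" "v = 2 ^ m * (2 * q + 3)"
proof -
  from assms obtain n :: int where
    n: "real_of_int u = 2 ^ Suc m * (real_of_int n - 1 / 2)"
       "real_of_int v = 2 ^ Suc m * (real_of_int n + 1 / 2)"
    by (auto simp: level_edges_def)
  have "real_of_int u = real_of_int (2 ^ m * (2 * (n - 1) + 1))"
    "real_of_int v = real_of_int (2 ^ m * (2 * (n - 1) + 3))"
    unfolding n by (simp_all add: algebra_simps)
  then show thesis
    by (intro that[of "n - 1"]) (simp_all only: of_int_eq_iff)
qed

lemma power2_dvd_odd_multiple:
  fixes c :: int
  assumes "odd c"
  shows "2 ^ b dvd 2 ^ m * c \<longleftrightarrow> b \<le> m"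
proof
  assume *: "2 ^ b dvd 2 ^ m * c"
  show "b \<le> m"
  proof (rule ccontr)
    assume "\<not> b \<le> m"
    then have "(2::int) ^ Suc m dvd 2 ^ b"
      by (intro le_imp_power_dvd) simp
    with * have "(2::int) ^ Suc m dvd 2 ^ m * c"
      by (rule dvd_trans[rotated])
    then show False
      using assms by simp
  qed
next
  assume "b \<le> m"
  then show "2 ^ b dvd 2 ^ m * c"
    by (intro dvd_mult2 le_imp_power_dvd)
qed

text \<open>The two equivalences say that \<open>u\<close> and \<open>v\<close> have 2-adic
  valuation exactly \<open>m\<close>, without a valuation function; they also exclude the endpoint
  0.\<close>

lemma hier_arc_cases:
  assumes "(u, v) \<in> parcs hier_graph"
  obtains "\<bar>v - u\<bar> = 1"
  | m where "\<bar>v - u\<bar> = 2 ^ Suc m"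
      "\<And>b. 2 ^ b dvd u \<longleftrightarrow> b \<le> m" "\<And>b. 2 ^ b dvd v \<longleftrightarrow> b \<le> m"
proof -
  from assms obtain k where k: "(u, v) \<in> level_edges k \<or> (v, u) \<in> level_edges k"
    by (auto simp: hier_graph_def)
  show thesis
  proof (cases k)
    case 0
    with k show thesis
      by (intro that(1)) (auto simp: level_edges_def)
  next
    case (Suc m)
    with k obtain q where q:
      "u = 2 ^ m * (2 * q + 1) \<and> v = 2 ^ m * (2 * q + 3) \<or>
       v = 2 ^ m * (2 * q + 1) \<and> u = 2 ^ m * (2 * q + 3)"
      by (metis level_edges_Suc_cases)
    have "v - u = 2 ^ Suc m \<or> v - u = - (2 ^ Suc m)"
      using q by (auto simp: algebra_simps)
    then have d: "\<bar>v - u\<bar> = 2 ^ Suc m"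
      by (elim disjE) simp_all
    have odd: "odd (2 * q + 1)" "odd (2 * q + 3)"
      by simp_all
    show thesis
      using q power2_dvd_odd_multiple[OF odd(1)] power2_dvd_odd_multiple[OF odd(2)]
      by (intro that(2)[OF d]) auto
  qed
qed

lemma hier_arc_unit_if_dvd_differs:
  assumes "(u, v) \<in> parcs hier_graph" "2 ^ b dvd u \<longleftrightarrow> \<not> 2 ^ b dvd v"
  shows "\<bar>v - u\<bar> = 1"
  using assms(1) by (rule hier_arc_cases) (use assms(2) in auto)

lemma hier_arc_unit_at_0:
  assumes "(0, v) \<in> parcs hier_graph"
  shows "\<bar>v\<bar> = 1"
  using assms
proof (rule hier_arc_cases)
  fix m assume "\<And>b. 2 ^ b dvd (0::int) \<longleftrightarrow> b \<le> m"
  from this[of "Suc m"] show ?thesis by simp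
qed simp

text \<open>A longer edge at \<open>u\<close> has length \<open>2 ^ Suc m\<close> with
  \<open>m\<close> the exact valuation of \<open>u\<close>. If \<open>2 ^ b\<close> does not divide
  \<open>u\<close>, then \<open>m < b\<close>; and 0 has only unit edges.\<close>

lemma hier_arc_length_le:
  assumes "(u, v) \<in> parcs hier_graph" "u = 0 \<or> \<not> 2 ^ b dvd u"
  shows "\<bar>v - u\<bar> \<le> 2 ^ b"
  using assms(1)
proof (rule hier_arc_cases)
  fix m assume d: "\<bar>v - u\<bar> = 2 ^ Suc m" and m: "\<And>b. 2 ^ b dvd u \<longleftrightarrow> b \<le> m"
  have "u \<noteq> 0" using m[of "Suc m"] by auto
  then have "Suc m \<le> b" using assms(2) m[of b] by auto
  then show ?thesis unfolding d by (rule power_increasing) simp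
qed simp

section \<open>Balls through powers of the arc relation\<close>

lemma awalk_imp_relpow:
  assumes "pre_digraph.awalk (with_proj hier_graph) u p v"
  shows "(u, v) \<in> parcs hier_graph ^^ length p"
proof -
  interpret wf_digraph "with_proj hier_graph" by (rule wf_hier_graph)
  show ?thesis using assms
    by (induction p arbitrary: u) (auto simp: awalk_simps simp del: relpow.simps(2) intro: relpow_Suc_I2)
qed

lemma relpow_imp_awalk:
  assumes "(u, v) \<in> parcs hier_graph ^^ n"
  obtains p where "pre_digraph.awalk (with_proj hier_graph) u p v" "length p = n"
proof -
  interpret wf_digraph "with_proj hier_graph" by (rule wf_hier_graph)
  have "\<exists>p. awalk u p v \<and> length p = n" using assms
  proof (induction n arbitrary: u)
    case 0
    moreover have "pverts hier_graph = UNIV" by (simp add: hier_graph_def)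
    ultimately show ?case by (simp add: awalk_simps)
  next
    case (Suc n)
    then obtain w where w: "(u, w) \<in> parcs hier_graph" "(w, v) \<in> parcs hier_graph ^^ n"
      by (meson relpow_Suc_D2)
    from Suc.IH[OF w(2)] obtain p where "awalk w p v" "length p = n" by auto
    with w(1) show ?case
      by (intro exI[of _ "(u, w) # p"]) (simp add: awalk_simps)
  qed
  with that show thesis by blast
qed

lemma hier_ball_conv_relpow:
  "hier_ball x j = {v. \<exists>n\<le>j. (x, v) \<in> parcs hier_graph ^^ n}"
proof -
  interpret wf_digraph "with_proj hier_graph" by (rule wf_hier_graph)
  have cost: "awalk_cost (\<lambda>_. 1) p = real (length p)" for p :: "(int \<times> int) list"
    by (induction p) auto
  have "hier_dist x v \<le> ereal (real j) \<longleftrightarrow> (\<exists>n\<le>j. (x, v) \<in> parcs hier_graph ^^ n)" for v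
  proof
    assume "hier_dist x v \<le> ereal (real j)"
    \<comment> \<open>Against a strict bound the infimum yields an actual walk; integrality of
      lengths recovers \<open>j\<close>.\<close>
    also have "ereal (real j) < ereal (real (Suc j))" by simp
    finally obtain p where p: "awalk x p v" "length p < Suc j"
      unfolding hier_dist_def \<mu>_def INF_less_iff by (auto simp: cost)
    then show "\<exists>n\<le>j. (x, v) \<in> parcs hier_graph ^^ n"
      using awalk_imp_relpow by (metis less_Suc_eq_le)
  next
    assume "\<exists>n\<le>j. (x, v) \<in> parcs hier_graph ^^ n"
    then obtain p where p: "awalk x p v" "length p \<le> j"
      by (metis relpow_imp_awalk)
    have "hier_dist x v \<le> ereal (real (length p))"
      using min_cost_le_walk_cost[OF p(1), of "\<lambda>_. 1"] by (simp add: hier_dist_def cost)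
    also have "\<dots> \<le> ereal (real j)" using p(2) by simp
    finally show "hier_dist x v \<le> ereal (real j)" .
  qed
  then show ?thesis
    by (auto simp: hier_ball_def hier_graph_def)
qed

lemma hier_ball_mono: "i \<le> j \<Longrightarrow> hier_ball x i \<subseteq> hier_ball x j"
  by (auto simp: hier_ball_conv_relpow) (meson le_trans)

lemma hier_ball_trans:
  assumes "v \<in> hier_ball u i" "w \<in> hier_ball v j"
  shows "w \<in> hier_ball u (i + j)"
  using assms by (auto simp: hier_ball_conv_relpow) (metis add_mono relpow_trans)

section \<open>Intervals contained in balls\<close>

lemma hier_ball_level_run:
  fixes v s :: int
  assumes "2 ^ Suc a dvd v" "s = 1 \<or> s = -1"
  shows "v + s * (2 ^ a * (2 * int i + 1)) \<in> hier_ball (v + s * 2 ^ a) i"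
proof -
  from assms(1) obtain w where w: "v = 2 ^ Suc a * w" by (auto elim: dvdE)
  have "(v + s * 2 ^ a, v + s * (2 ^ a * (2 * int i + 1))) \<in> parcs hier_graph ^^ i"
  proof (induction i)
    case (Suc i)
    have "(v + s * (2 ^ a * (2 * int i + 1)), v + s * (2 ^ a * (2 * int (Suc i) + 1)))
        \<in> parcs hier_graph"
      using assms(2)
    proof
      assume "s = 1"
      then show ?thesis
        using hier_arc_level(1)[of a "w + int i"] by (simp add: w algebra_simps)
    next
      assume "s = - 1"
      then show ?thesis
        \<comment> \<open>The leftward arc starts at \<open>2 ^ a * (2 * (w - int i) - 1)\<close>,
          which must be the upper endpoint \<open>2 ^ a * (2 * q + 3)\<close>.\<close>
        using hier_arc_level(2)[of a "w - int i - 2"] by (simp add: w algebra_simps)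
    qed
    then show ?case using Suc by (rule relpow_Suc_I[rotated])
  qed simp
  then show ?thesis by (auto simp: hier_ball_conv_relpow)
qed

text \<open>The intervals of radius \<open>2 ^ a\<close> around the first \<open>2 ^ d\<close> odd
  multiples of \<open>2 ^ a\<close> tile the range of \<open>\<rho>\<close>, and \<open>i\<close> is
  the quotient by \<open>2 ^ Suc a\<close>. The right endpoint is separate because its quotient
  \<open>2 ^ d\<close> would be one too large.\<close>

lemma near_odd_multiple:
  fixes \<rho> :: int
  assumes "0 \<le> \<rho>" "\<rho> \<le> 2 ^ (a + 1 + d)"
  obtains i :: nat where "i < 2 ^ d" "\<bar>\<rho> - 2 ^ a * (2 * int i + 1)\<bar> \<le> 2 ^ a"
proof (cases "\<rho> = 2 ^ (a + 1 + d)")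
  case True
  have "int (2 ^ d - 1) = 2 ^ d - 1" by (simp add: of_nat_diff)
  with True show thesis
    by (intro that[of "2 ^ d - 1"]) (simp_all add: algebra_simps power_add)
next
  case False
  define P :: int where "P = 2 ^ Suc a"
  have "P > 0" by (simp add: P_def)
  have "\<rho> < 2 ^ d * P" using assms(2) False by (simp add: P_def power_add mult_ac less_le)
  have nn: "\<rho> div P \<ge> 0" using assms(1) \<open>P > 0\<close> by (simp add: pos_imp_zdiv_nonneg_iff)
  have eq: "\<rho> = P * (\<rho> div P) + \<rho> mod P" by simp
  have md: "0 \<le> \<rho> mod P" "\<rho> mod P < P" using \<open>P > 0\<close> by simp_all
  have lt: "\<rho> div P < 2 ^ d"
  proof (rule ccontr)
    assume "\<not> \<rho> div P < 2 ^ d"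
    then have "P * 2 ^ d \<le> P * (\<rho> div P)" using \<open>P > 0\<close> by simp
    with \<open>\<rho> < 2 ^ d * P\<close> eq md show False by (simp add: mult.commute)
  qed
  have "2 ^ a * (2 * (\<rho> div P) + 1) = P * (\<rho> div P) + 2 ^ a" "P = 2 * 2 ^ a"
    by (simp_all add: P_def algebra_simps)
  then have "\<bar>\<rho> - 2 ^ a * (2 * (\<rho> div P) + 1)\<bar> \<le> 2 ^ a"
    using eq md by linarith
  moreover have "nat (\<rho> div P) < 2 ^ d"
    using lt nn by (simp add: nat_less_iff)
  ultimately show thesis using nn by (intro that[of "nat (\<rho> div P)"]) auto
qed

text \<open>Radius recursion: reach an odd multiple of \<open>2 ^ a\<close>, run along level \<open>a\<close>, then descend.\<close>

lemma interval_in_hier_ball_step: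
  assumes IH: "\<And>v r. 2 ^ a dvd v \<Longrightarrow> \<bar>r\<bar> \<le> 2 ^ a \<Longrightarrow> v + r \<in> hier_ball v c"
    and v: "2 ^ (a + 1 + d) dvd v" and r: "\<bar>r\<bar> \<le> 2 ^ (a + 1 + d)"
  shows "v + r \<in> hier_ball v (2 * c + 2 ^ d - 1)"
proof -
  define s :: int where "s = (if r \<ge> 0 then 1 else -1)"
  have s: "s = 1 \<or> s = -1" and rs: "r = s * \<bar>r\<bar>" by (auto simp: s_def)
  have dv: "2 ^ Suc a dvd v" "2 ^ a dvd v"
    by (rule dvd_trans[OF le_imp_power_dvd v]; simp)+
  obtain i :: nat where i: "i < 2 ^ d" "\<bar>\<bar>r\<bar> - 2 ^ a * (2 * int i + 1)\<bar> \<le> 2 ^ a"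
    using near_odd_multiple[of "\<bar>r\<bar>" a d] r by auto
  define u where "u = v + s * (2 ^ a * (2 * int i + 1))"
  have "v + s * 2 ^ a \<in> hier_ball v c"
    using s by (intro IH dv) auto
  moreover have "u \<in> hier_ball (v + s * 2 ^ a) i"
    unfolding u_def by (rule hier_ball_level_run[OF dv(1) s])
  moreover have "v + r \<in> hier_ball u c"
  proof -
    have "2 ^ a dvd u" unfolding u_def using dv(2) by simp
    moreover have "\<bar>v + r - u\<bar> \<le> 2 ^ a"
      using s i(2) rs unfolding u_def by (auto simp: algebra_simps)
    ultimately show ?thesis using IH[of u "v + r - u"] by simp
  qed
  ultimately have "v + r \<in> hier_ball v (c + i + c)"
    by (blast intro: hier_ball_trans)
  also have "\<dots> \<subseteq> hier_ball v (2 * c + 2 ^ d - 1)"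
    using i(1) by (intro hier_ball_mono) linarith
  finally show ?thesis .
qed

lemma growth_p_minus_1_Suc: "growth_p (Suc n) - 1 = (growth_p n - 1) + n + 2"
proof -
  have "(Suc n)\<^sup>2 + 3 * Suc n + 2 = (n\<^sup>2 + 3 * n + 2) + 2 * (n + 2)"
    by (simp add: power2_eq_square)
  then have "growth_p (Suc n) = (n\<^sup>2 + 3 * n + 2 + 2 * (n + 2)) div 2"
    by (simp only: growth_p_def)
  also have "\<dots> = (n + 2) + growth_p n"
    unfolding growth_p_def by (rule div_mult_self2) simp
  finally have "growth_p (Suc n) = growth_p n + n + 2" by simp
  moreover have "growth_p n \<ge> 1" by (simp add: growth_p_def)
  ultimately show ?thesis by linarith
qed

lemma two_growth_p_minus_1: "2 * (growth_p n - 1) = n * (n + 3)"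
proof (induction n)
  case (Suc n)
  then show ?case unfolding growth_p_minus_1_Suc by (simp add: algebra_simps)
qed (simp add: growth_p_def)

text \<open>Induction by the radius recursion with \<open>d = Suc n\<close>: the exponent gap is
  \<open>1 + Suc n\<close>, and doubling \<open>n * 2 ^ n + 1\<close> and adding
  \<open>2 ^ Suc n - 1\<close> gives the next radius.\<close>

lemma interval_in_hier_ball:
  assumes "2 ^ (growth_p n - 1) dvd v" "\<bar>r\<bar> \<le> 2 ^ (growth_p n - 1)"
  shows "v + r \<in> hier_ball v (n * 2 ^ n + 1)"
  using assms
proof (induction n arbitrary: v r)
  case 0
  then have "r = 0 \<or> r = 1 \<or> r = -1" by (auto simp: growth_p_def)
  moreover have "(v, v - 1) \<in> parcs hier_graph" using hier_arc_unit(2)[of "v - 1"] by simp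
  ultimately have "(v, v + r) \<in> parcs hier_graph ^^ nat \<bar>r\<bar>"
    using hier_arc_unit(1)[of v] by auto
  with 0 show ?case
    by (auto simp: hier_ball_conv_relpow growth_p_def intro!: exI[of _ "nat \<bar>r\<bar>"])
next
  case (Suc n)
  have e: "growth_p (Suc n) - 1 = (growth_p n - 1) + 1 + Suc n"
    unfolding growth_p_minus_1_Suc by simp
  have c: "Suc n * 2 ^ Suc n + 1 = 2 * (n * 2 ^ n + 1) + 2 ^ Suc n - 1"
    by (simp add: algebra_simps)
  show ?case
    unfolding c
    by (rule interval_in_hier_ball_step) (fact Suc.IH Suc.prems[unfolded e])+
qed

section \<open>Lower bounds for travel times\<close>

lemma walk_displacement_le:
  fixes p :: "nat \<Rightarrow> int"
  assumes "s \<le> t" "\<And>i. s \<le> i \<Longrightarrow> i < t \<Longrightarrow> \<bar>p (Suc i) - p i\<bar> \<le> c"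
  shows "\<bar>p t - p s\<bar> \<le> c * int (t - s)"
  using assms
proof (induction t rule: dec_induct)
  case (step t)
  have "\<bar>p t - p s\<bar> \<le> c * int (t - s)" "\<bar>p (Suc t) - p t\<bar> \<le> c"
    using step by auto
  moreover have "int (Suc t - s) = int (t - s) + 1" using step.hyps by simp
  ultimately show ?case by (simp add: algebra_simps)
qed simp

text \<open>Integrality matters: equality holds at 1 and 2, and by convexity the inequality fails
  strictly between them. \<open>powr\<close> admits the negative \<open>x\<close> that arise in
  \<open>travel_bound_step\<close>.\<close>

lemma le_two_power_pred: "x \<le> 2 powr (x - 1)" if "x \<in> \<int>" for x :: real
proof -
  from that obtain z where z: "x = of_int z" by (auto elim: Ints_cases)
  show ?thesis
  proof (cases "z \<ge> 1")
    case True
    define n where "n = nat (z - 1)"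
    have x: "x = real n + 1" using True by (simp add: n_def z)
    have "real (Suc n) \<le> real (2 ^ n)"
      using less_exp[of n] by (simp only: of_nat_le_iff Suc_le_eq)
    then show ?thesis by (simp add: x powr_realpow)
  next
    case False
    then have "x \<le> 0" by (simp add: z)
    then show ?thesis by (meson order_trans powr_ge_zero)
  qed
qed

text \<open>The affine functions \<open>travel_bound k\<close> of \<open>b\<close> are the supporting lines of the convex solution
  of \<open>c 0 = 1\<close>, \<open>c b = Min_{a < b} (2 * c a + 2 ^ (b - a - 1) - 1)\<close>, the recursion satisfied by
  the distance between neighbouring multiples of \<open>2 ^ b\<close>.\<close>

definition travel_bound :: "nat \<Rightarrow> nat \<Rightarrow> real" where
  "travel_bound k b = 2 ^ k * (real b - real k * (real k + 1) / 2) + 1"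

lemma travel_bound_0: "travel_bound k 0 \<le> 1"
  by (simp add: travel_bound_def mult_nonneg_nonpos)

text \<open>Doubling the line \<open>k - 1\<close> restores the slope \<open>2 ^ k\<close>, so
  \<open>k' = k - 1\<close> is chosen; \<open>k = 0\<close> has no predecessor and keeps
  \<open>k' = 0\<close>.\<close>

lemma travel_bound_step:
  assumes "a < b"
  shows "\<exists>k'. travel_bound k b \<le> 2 * travel_bound k' a + 2 ^ (b - a - 1) - 1"
proof (cases k)
  case 0
  define d where "d = b - a - 1"
  have b: "real b = real a + real d + 1" using assms by (simp add: d_def)
  have "real (Suc d) \<le> real (2 ^ d)"
    using less_exp[of d] by (simp only: of_nat_le_iff Suc_le_eq)
  then have "travel_bound k b \<le> 2 * travel_bound 0 a + 2 ^ d - 1"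
    by (simp add: travel_bound_def 0 b)
  then show ?thesis unfolding d_def by blast
next
  case (Suc m)
  \<comment> \<open>The claim reduces to \<open>x \<le> 2 powr (x - 1)\<close> scaled by
    \<open>2 ^ k\<close>.\<close>
  define x where "x = real b - real a - real k"
  have "x \<in> \<int>" by (simp add: x_def)
  then have "2 ^ k * x \<le> 2 ^ k * 2 powr (x - 1)"
    by (simp add: le_two_power_pred)
  also have "\<dots> = 2 powr (real k + (x - 1))"
    by (simp only: powr_add) (simp add: powr_realpow)
  also have "real k + (x - 1) = real (b - a - 1)"
    using assms by (simp add: x_def)
  also have "2 powr real (b - a - 1) = 2 ^ (b - a - 1)"
    by (simp add: powr_realpow)
  finally have *: "2 ^ k * x \<le> 2 ^ (b - a - 1)" .
  have "travel_bound k b = 2 * travel_bound m a + 2 ^ k * x - 1"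
    by (simp add: travel_bound_def x_def Suc field_simps)
  with * show ?thesis by (intro exI[of _ m]) simp
qed

text \<open>Cut at the first and last visits to the multiples of \<open>2 ^ a\<close>, where \<open>a\<close> is the highest level
  met inside: both end pieces cost the same bound for \<open>a\<close>, hence the factor 2 in the recursion, and
  the middle moves by at most \<open>2 ^ (a + 1)\<close> per step. The term with \<open>p t - p s\<close> makes the
  displacement of the end pieces count as well.\<close>

lemma walk_length_ge:
  fixes p :: "nat \<Rightarrow> int"
  assumes "\<And>i. s \<le> i \<Longrightarrow> i < t \<Longrightarrow> (p i, p (Suc i)) \<in> parcs hier_graph"
    and "s < t" "2 ^ b dvd p s" "2 ^ b dvd p t" "p s \<noteq> p t"
    and "\<And>i. s < i \<Longrightarrow> i < t \<Longrightarrow> \<not> 2 ^ b dvd p i"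
    and "t = Suc s \<Longrightarrow> \<bar>p t - p s\<bar> = 1"
  shows "real (t - s) \<ge> \<bar>real_of_int (p t - p s)\<bar> / 2 ^ Suc b + travel_bound k b - 1 / 2"
  using assms
proof (induction b arbitrary: s t k rule: less_induct)
  case (less b)
  note arc = less.prems(1)
  define D where "D = \<bar>real_of_int (p t - p s)\<bar>"
  have "2 ^ b dvd p t - p s" "p t - p s \<noteq> 0" using less.prems by auto
  then have "2 ^ b \<le> \<bar>p t - p s\<bar>"
    using dvd_imp_le_int[of "p t - p s" "2 ^ b"] by simp
  then have "real_of_int (2 ^ b) \<le> real_of_int \<bar>p t - p s\<bar>"
    by (simp only: of_int_le_iff)
  then have Dge: "D \<ge> 2 ^ b" by (simp add: D_def)
  show ?case
  proof (cases "b = 0")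
    case True
    \<comment> \<open>Everything is divisible by \<open>2 ^ 0\<close>, so there is no interior
      vertex: the walk is one unit step, and the bound is at most 1 / 2 + 1 - 1 / 2.\<close>
    have t: "t = Suc s"
      using less.prems(2) less.prems(6)[of "Suc s"] True by (cases "t = Suc s") auto
    then have "D = 1" using less.prems(7) by (simp add: D_def flip: of_int_abs)
    then show ?thesis using travel_bound_0[of k] t by (simp add: True D_def)
  next
    case False
    have "t \<noteq> Suc s"
    proof
      assume "t = Suc s"
      then have "\<bar>p t - p s\<bar> = 1" by (rule less.prems(7))
      moreover have "(2::int) ^ 1 \<le> 2 ^ b" using False by (intro power_increasing) auto
      ultimately show False using \<open>2 ^ b \<le> \<bar>p t - p s\<bar>\<close> by simp
    qed
    define hit where "hit a i \<longleftrightarrow> s < i \<and> i < t \<and> 2 ^ a dvd p i" for a i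
    define A where "A = {a. \<exists>i. hit a i}"
    have "0 \<in> A" using \<open>t \<noteq> Suc s\<close> less.prems(2)
      by (auto simp: A_def hit_def intro!: exI[of _ "Suc s"])
    have A_less: "a < b" if "a \<in> A" for a
    proof (rule ccontr)
      assume "\<not> a < b"
      then have *: "(2::int) ^ b dvd 2 ^ a" by (intro le_imp_power_dvd) simp
      from that obtain i where "s < i" "i < t" "2 ^ a dvd p i" by (auto simp: A_def hit_def)
      with less.prems(6)[of i] dvd_trans[OF *, of "p i"] show False by simp
    qed
    then have "A \<subseteq> {..<b}" by auto
    then have "finite A" by (rule finite_subset) simp
    define a where "a = Max A"
    have "a \<in> A" unfolding a_def using \<open>finite A\<close> \<open>0 \<in> A\<close> by (intro Max_in) auto
    have "Suc a \<notin> A" using Max_ge[OF \<open>finite A\<close>, of "Suc a"] by (auto simp: a_def)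
    have "a < b" using A_less \<open>a \<in> A\<close> .
    have "(2::int) ^ a dvd 2 ^ b" using \<open>a < b\<close> by (intro le_imp_power_dvd) simp
    then have ends: "2 ^ a dvd p s" "2 ^ a dvd p t"
      using less.prems(3,4) by (blast intro: dvd_trans)+
    define H where "H = {i. hit a i}"
    have "H \<subseteq> {..<t}" by (auto simp: H_def hit_def)
    then have H: "finite H" by (rule finite_subset) simp
    have "H \<noteq> {}" using \<open>a \<in> A\<close> by (auto simp: H_def A_def)
    define u1 where "u1 = Min H"
    define u2 where "u2 = Max H"
    have hits: "hit a u1" "hit a u2"
      using Min_in[OF H \<open>H \<noteq> {}\<close>] Max_in[OF H \<open>H \<noteq> {}\<close>] by (auto simp: u1_def u2_def H_def)
    have "u1 \<le> u2" unfolding u2_def using hits(1) by (intro Max_ge H) (simp add: H_def)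
    have before: "\<not> 2 ^ a dvd p i" if "s < i" "i < u1" for i
    proof -
      have "i \<notin> H" using that(2) Min_le[OF H, of i] by (auto simp: u1_def)
      then show ?thesis using that hits(1) by (simp add: H_def hit_def)
    qed
    have after: "\<not> 2 ^ a dvd p i" if "u2 < i" "i < t" for i
    proof -
      have "i \<notin> H" using that(1) Max_ge[OF H, of i] by (auto simp: u2_def)
      then show ?thesis using that hits(2) by (simp add: H_def hit_def)
    qed
    have nb: "\<not> 2 ^ b dvd p u1" "\<not> 2 ^ b dvd p u2"
      using less.prems(6) hits by (auto simp: hit_def)
    obtain k' where k': "travel_bound k b \<le> 2 * travel_bound k' a + 2 ^ (b - a - 1) - 1"
      using travel_bound_step[OF \<open>a < b\<close>] by blast
    define D1 D2 D3 where "D1 = \<bar>real_of_int (p u1 - p s)\<bar>"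
      and "D2 = \<bar>real_of_int (p u2 - p u1)\<bar>" and "D3 = \<bar>real_of_int (p t - p u2)\<bar>"
    \<comment> \<open>Only \<open>p s\<close> is divisible by \<open>2 ^ b\<close>, so
      \<open>p s\<close> and \<open>p u1\<close> differ, and a single arc between them is a unit
      edge.\<close>
    have start: "real (u1 - s) \<ge> D1 / 2 ^ Suc a + travel_bound k' a - 1 / 2"
      unfolding D1_def
    proof (rule less.IH[OF \<open>a < b\<close>])
      show "\<bar>p u1 - p s\<bar> = 1" if "u1 = Suc s"
        using that arc[of s] less.prems(2,3) nb hits
        by (intro hier_arc_unit_if_dvd_differs[where b = b]) auto
    qed (use hits arc less.prems(3) nb ends before in \<open>auto simp: hit_def\<close>)
    have finish: "real (t - u2) \<ge> D3 / 2 ^ Suc a + travel_bound k' a - 1 / 2"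
      unfolding D3_def
    proof (rule less.IH[OF \<open>a < b\<close>])
      show "\<bar>p t - p u2\<bar> = 1" if "t = Suc u2"
        using that arc[of u2] less.prems(2,4) nb hits
        by (intro hier_arc_unit_if_dvd_differs[where b = b]) (auto simp: hit_def)
      show "p u2 \<noteq> p t" using nb less.prems(4) by auto
    qed (use hits arc less.prems(4) nb ends after in \<open>auto simp: hit_def\<close>)
    have "\<bar>p u2 - p u1\<bar> \<le> 2 ^ Suc a * int (u2 - u1)"
    proof (rule walk_displacement_le[OF \<open>u1 \<le> u2\<close>])
      fix i assume i: "u1 \<le> i" "i < u2"
      then have "\<not> 2 ^ Suc a dvd p i"
        using \<open>Suc a \<notin> A\<close> hits by (auto simp: A_def hit_def)
      then show "\<bar>p (Suc i) - p i\<bar> \<le> 2 ^ Suc a"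
        using i hits by (intro hier_arc_length_le[OF arc]) (auto simp: hit_def)
    qed
    then have "real_of_int \<bar>p u2 - p u1\<bar> \<le> real_of_int (2 ^ Suc a * int (u2 - u1))"
      by (simp only: of_int_le_iff)
    then have middle: "real (u2 - u1) \<ge> D2 / 2 ^ Suc a"
      by (simp add: D2_def field_simps)
    have "D \<le> D1 + D2 + D3" unfolding D_def D1_def D2_def D3_def by simp
    then have "D / 2 ^ Suc a \<le> D1 / 2 ^ Suc a + D2 / 2 ^ Suc a + D3 / 2 ^ Suc a"
      by (simp add: divide_right_mono flip: add_divide_distrib)
    moreover have "real (t - s) = real (u1 - s) + real (u2 - u1) + real (t - u2)"
      using hits \<open>u1 \<le> u2\<close> by (simp add: hit_def of_nat_diff)
    ultimately have T: "real (t - s) \<ge> D / 2 ^ Suc a + 2 * travel_bound k' a - 1"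
      using start middle finish by linarith
    \<comment> \<open>Since \<open>D \<ge> 2 ^ b\<close>, lowering the weight of \<open>D\<close>
      from \<open>1 / 2 ^ Suc a\<close> to \<open>1 / 2 ^ Suc b\<close> releases enough to pay for
      the term \<open>2 ^ (b - a - 1)\<close> in the recursion.\<close>
    have "2 ^ (b - a - 1) - 1 / 2 \<le> D / 2 ^ Suc a - D / 2 ^ Suc b"
    proof -
      have "b = (b - a - 1) + Suc a" using \<open>a < b\<close> by simp
      then have e: "(2::real) ^ b = 2 ^ (b - a - 1) * 2 ^ Suc a"
        by (metis power_add)
      have "(1::real) / 2 ^ Suc b \<le> 1 / 2 ^ Suc a"
        using \<open>a < b\<close> by (intro divide_left_mono power_increasing) auto
      then have "2 ^ b * (1 / 2 ^ Suc a - 1 / 2 ^ Suc b) \<le> D * (1 / 2 ^ Suc a - 1 / 2 ^ Suc b)"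
        using Dge by (intro mult_right_mono) auto
      moreover have "2 ^ b * (1 / 2 ^ Suc a - 1 / 2 ^ Suc b) = (2::real) ^ (b - a - 1) - 1 / 2"
      proof -
        have "(2::real) ^ b * (1 / 2 ^ Suc b) = 1 / 2" by simp
        moreover have "(2::real) ^ b * (1 / 2 ^ Suc a) = 2 ^ (b - a - 1)" unfolding e by simp
        ultimately show ?thesis by (simp only: right_diff_distrib)
      qed
      ultimately show ?thesis by (simp add: algebra_simps)
    qed
    with T k' show ?thesis by (simp add: D_def)
  qed
qed

section \<open>Confinement of balls and the cardinality bounds\<close>

lemma hier_ball_0_subset:
  assumes "j < Suc n * 2 ^ Suc n + 1"
  shows "hier_ball 0 j \<subseteq> {- (int j * 2 ^ (growth_p (Suc n) - 1)) .. int j * 2 ^ (growth_p (Suc n) - 1)}"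
proof
  define N where "N = growth_p (Suc n) - 1"
  fix x assume "x \<in> hier_ball 0 j"
  then obtain T where T: "T \<le> j" "(0, x) \<in> parcs hier_graph ^^ T"
    by (auto simp: hier_ball_conv_relpow)
  then obtain p where p: "p 0 = 0" "p T = x" "\<And>i. i < T \<Longrightarrow> (p i, p (Suc i)) \<in> parcs hier_graph"
    by (auto simp: relpow_fun_conv)
  have low: "p i = 0 \<or> \<not> 2 ^ N dvd p i" if "i \<le> T" for i
    using that
  proof (induction i rule: less_induct)
    case (less t)
    show ?case
    proof (rule ccontr)
      assume "\<not> ?thesis"
      then have t: "p t \<noteq> 0" "2 ^ N dvd p t" by auto
      \<comment> \<open>By induction no vertex before \<open>t\<close> is a nonzero multiple of
        \<open>2 ^ N\<close>; hence after the last visit to 0 no multiple at all is met before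
        \<open>t\<close>, and \<open>walk_length_ge\<close> applies.\<close>
      define Z where "Z = {i. i < t \<and> p i = 0}"
      have "t > 0" using t p(1) by (cases t) auto
      then have Z: "finite Z" "Z \<noteq> {}" using p(1) by (auto simp: Z_def)
      define s where "s = Max Z"
      have s: "s < t" "p s = 0" using Max_in[OF Z] by (auto simp: s_def Z_def)
      have int: "\<not> 2 ^ N dvd p i" if "s < i" "i < t" for i
      proof -
        have "i \<notin> Z" using that(1) Max_ge[OF Z(1), of i] by (auto simp: s_def)
        then show ?thesis using less.IH[of i] less.prems that by (auto simp: Z_def)
      qed
      \<comment> \<open>The line \<open>k = Suc n\<close> has the value
        \<open>Suc n * 2 ^ Suc n + 1\<close> at \<open>N\<close>; the displacement term is at least
        1 / 2 and cancels the \<open>- 1 / 2\<close>.\<close>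
      have "real (t - s) \<ge> \<bar>real_of_int (p t - p s)\<bar> / 2 ^ Suc N + travel_bound (Suc n) N - 1 / 2"
      proof (rule walk_length_ge)
        show "\<bar>p t - p s\<bar> = 1" if "t = Suc s"
          using p(3)[of s] that s less.prems by (simp add: hier_arc_unit_at_0)
      qed (use t s p less.prems int in auto)
      moreover have "\<bar>real_of_int (p t - p s)\<bar> / 2 ^ Suc N \<ge> 1 / 2"
      proof -
        have "2 ^ N \<le> \<bar>p t\<bar>" using t dvd_imp_le_int[of "p t" "2 ^ N"] by simp
        then have "real_of_int (2 ^ N) \<le> real_of_int \<bar>p t\<bar>"
          by (simp only: of_int_le_iff)
        then have "(2::real) ^ N \<le> \<bar>real_of_int (p t)\<bar>" by simp
        then show ?thesis using s by (simp add: field_simps)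
      qed
      moreover have "travel_bound (Suc n) N = real (Suc n * 2 ^ Suc n + 1)"
      proof -
        have "real (2 * N) = real (Suc n * (Suc n + 3))"
          unfolding N_def two_growth_p_minus_1 ..
        then have N: "real N = real (Suc n) * (real (Suc n) + 3) / 2" by (simp add: algebra_simps)
        show ?thesis unfolding travel_bound_def N by (simp add: field_simps)
      qed
      moreover have "real (t - s) \<le> real j" using less.prems T(1) by simp
      ultimately have "real (Suc n * 2 ^ Suc n + 1) \<le> real j" by linarith
      then show False using assms by (simp only: of_nat_le_iff)
    qed
  qed
  have "\<bar>p T - p 0\<bar> \<le> 2 ^ N * int (T - 0)"
    using low p(3) by (intro walk_displacement_le hier_arc_length_le) auto
  also have "\<dots> \<le> int j * 2 ^ N" using T(1) by simp
  finally show "x \<in> {- (int j * 2 ^ N) .. int j * 2 ^ N}" using p by auto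
qed

text \<open>The \<open>Sup\<close> is a maximum: the set is finite because
  \<open>n \<le> n * 2 ^ n\<close>, and \<open>j \<ge> 1\<close> puts 0 into it.\<close>

lemma growth_f_bounds:
  assumes "j \<ge> 1"
  shows "growth_f j * 2 ^ growth_f j + 1 \<le> j" "j < Suc (growth_f j) * 2 ^ Suc (growth_f j) + 1"
proof -
  define S where "S = {n. n * 2 ^ n + 1 \<le> j}"
  have "n \<le> j" if "n \<in> S" for n
  proof -
    have "n \<le> n * 2 ^ n" by simp
    also have "\<dots> \<le> j" using that by (simp add: S_def)
    finally show ?thesis .
  qed
  then have fin: "finite S" by (meson finite_nat_set_iff_bounded_le)
  moreover have "0 \<in> S" using assms by (simp add: S_def)
  ultimately have f: "growth_f j = Max S"
    unfolding growth_f_def S_def[symmetric] by (intro cSup_eq_Max) auto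
  have "Max S \<in> S" using fin \<open>0 \<in> S\<close> by (intro Max_in) auto
  then show "growth_f j * 2 ^ growth_f j + 1 \<le> j" unfolding f by (simp add: S_def)
  have "Suc (Max S) \<notin> S" using Max_ge[OF fin, of "Suc (Max S)"] by auto
  then show "j < Suc (growth_f j) * 2 ^ Suc (growth_f j) + 1" unfolding f by (simp add: S_def)
qed

theorem lemma4:
  fixes j :: nat
  assumes "j \<ge> 1"
  shows "growth_F j \<le> card (hier_ball 0 j) \<and>
         card (hier_ball 0 j) \<le> 16 * j ^ 2 * growth_F j"
proof
  define n where "n = growth_f j"
  define g where "g = growth_g j"
  have g: "g = 2 ^ (growth_p n - 1)" by (simp add: g_def growth_g_def n_def)
  note f = growth_f_bounds[OF assms, folded n_def]
  define M where "M = j * 2 ^ (growth_p (Suc n) - 1)"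
  have sub: "hier_ball 0 j \<subseteq> {- int M .. int M}"
    using hier_ball_0_subset[OF f(2)] by (simp add: M_def)
  have "{- int g .. int g} \<subseteq> hier_ball 0 j"
  proof
    fix r assume "r \<in> {- int g .. int g}"
    then have "0 + r \<in> hier_ball 0 (n * 2 ^ n + 1)"
      by (intro interval_in_hier_ball) (auto simp: g)
    then show "r \<in> hier_ball 0 j" using hier_ball_mono[OF f(1)] by auto
  qed
  \<comment> \<open>\<open>sub\<close> also makes the ball finite, so that its \<open>card\<close>
    is not the default 0.\<close>
  then have "card {- int g .. int g} \<le> card (hier_ball 0 j)"
    using sub by (intro card_mono) (auto intro: finite_subset)
  then show "growth_F j \<le> card (hier_ball 0 j)"
    by (simp add: growth_F_def g_def)
  \<comment> \<open>This absorbs the factor \<open>2 ^ (n + 2)\<close> between consecutive exponents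
    into \<open>4 * j\<close>.\<close>
  have "2 ^ n \<le> j"
  proof (cases "n = 0")
    case False
    then have "2 ^ n \<le> n * 2 ^ n" by simp
    also have "\<dots> \<le> j" using f(1) by simp
    finally show ?thesis .
  qed (use assms in simp)
  then have "2 ^ (growth_p (Suc n) - 1) \<le> 4 * g * j"
    unfolding growth_p_minus_1_Suc g by (simp add: power_add)
  then have "M \<le> j * (4 * g * j)" unfolding M_def by (rule mult_le_mono2)
  then have M: "M \<le> 4 * (j\<^sup>2 * g)" by (simp add: power2_eq_square algebra_simps)
  have "1 \<le> j\<^sup>2" using assms by simp
  have "card (hier_ball 0 j) \<le> card {- int M .. int M}"
    using sub by (intro card_mono) auto
  also have "\<dots> = 2 * M + 1" by simp
  also have "\<dots> \<le> 8 * (j\<^sup>2 * g) + j\<^sup>2" using M \<open>1 \<le> j\<^sup>2\<close> by linarith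
  also have "\<dots> \<le> 16 * j\<^sup>2 * growth_F j" by (simp add: growth_F_def g_def algebra_simps)
  finally show "card (hier_ball 0 j) \<le> 16 * j\<^sup>2 * growth_F j" .
qed

end
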